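(* Let $0<s<1$ and let $E$ be a subset of the Cantor dyadic group $G$. If there is a non-atomic mass distribution $\mu$ on $E$ such that the series $\sum_{k=0}^{\infty}\widehat{\phi_s}(k)(\widehat{\mu}(k))^2$ is convergent, then the Hausdorff dimension of $E$ (with respect to the metric $\rho$) satisfies $\dim_H(E)\ge s$.
   Context: The Cantor dyadic group $G$ is the set of all sequences $x=\{x_j\}_{j=1}^\infty$ with $x_j\in\{0,1\}$, with coordinate-wise addition modulo 2, topologized by the subgroups $G_n=\{x\in G: x_j=0,\ 1\le j\le n\}$ ($G_0=G$) as a base of neighborhoods of $0$. It is metrized by $\rho(x,y)=\sum_{i=1}^\infty 2^{-i}|x_i-y_i|$. Let $\lambda$ be the normalized Haar measure on $G$, $\lambda(G)=1$. For $n\ge 1$ let $K_n^2=G_{n-1}\setminus G_n$ (the coset of $G_n$ consisting of $x$ with $x_1=\dots=x_{n-1}=0$, $x_n=1$), so that $G\setminus\{0\}$ is the disjoint union of the sets $K_n^2$, $n\ge1$. The $s$-kernel is the function $\phi_s$ on $G$ given by $\phi_s(0)=0$ and $\phi_s(x)=2^{s(n-1)}$ if $x\in K_n^2$, $n\ge 1$. A mass distribution on a set $E\subset G$ is a nonzero finite positive Borel measure $\mu$ on $G$ supported on $E$ (that is, $G\setminus E$ is $\mu$-null). It is non-atomic if $\mu(\{x\})=0$ for every $x\in G$. Walsh functions: for an integer $k\ge0$ with dyadic expansion $k=\sum_{i\ge 0} k_i2^i$, $k_i\in\{0,1\}$, put $w_k(x)=(-1)^{\sum_{i\ge 0} k_ix_{i+1}}$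 (so $w_0\equiv1$). Walsh–Fourier coefficients are $\widehat{f}(k)=\int_G f\,w_k\,d\lambda$ for $f\in L^1(\lambda)$ and $\widehat{\mu}(k)=\int_G w_k\,d\mu$. For $A\subset G$ and $\delta>0$, $H^s_\delta(A)=\inf\{\sum_{i=1}^\infty(\operatorname{diam} I_i)^s: A\subset\bigcup_{i=1}^\infty I_i,\ \operatorname{diam} I_i<\delta \text{ for all } i\}$ with diameters taken in $\rho$; $H^s(A)=\lim_{\delta\to0}H^s_\delta(A)$; and $\dim_H(A)=\inf\{s: H^s(A)=0\}$. *)

theory Defs
  imports "HOL-Probability.Probability"
begin

text \<open>
  The Cantor dyadic group. Digits are booleans and are indexed from 0: \<open>seq x i\<close> is the digit $x_{i+1}$ of the usual
  1-based notation $x = (x_1, x_2, \dots)$.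
\<close>

typedef cantor = "UNIV :: (nat \<Rightarrow> bool) set"
  morphisms seq Cantor by simp

setup_lifting type_definition_cantor

lemma seq_Cantor [simp]: "seq (Cantor f) = f"
  by (simp add: Cantor_inverse)

lemma cantor_eq_iff: "x = y \<longleftrightarrow> (\<forall>i. seq x i = seq y i)"
  by (simp add: seq_inject[symmetric] fun_eq_iff)

instantiation cantor :: ab_group_add
begin

lift_definition zero_cantor :: cantor is "\<lambda>_. False" .
lift_definition plus_cantor :: "cantor \<Rightarrow> cantor \<Rightarrow> cantor" is "\<lambda>x y i. x i \<noteq> y i" .
lift_definition uminus_cantor :: "cantor \<Rightarrow> cantor" is "\<lambda>x. x" .
lift_definition minus_cantor :: "cantor \<Rightarrow> cantor \<Rightarrow> cantor" is "\<lambda>x y i. x i \<noteq> y i" .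

instance
  by standard (transfer; auto)+

end

lemma seq_zero [simp]: "seq 0 i = False"
  by (simp add: zero_cantor.rep_eq)

lemma seq_plus [simp]: "seq (x + y) i = (seq x i \<noteq> seq y i)"
  by (simp add: plus_cantor.rep_eq)

lemma seq_minus [simp]: "seq (x - y) i = (seq x i \<noteq> seq y i)"
  by (simp add: minus_cantor.rep_eq)

definition rho :: "cantor \<Rightarrow> cantor \<Rightarrow> real" where
  "rho x y = (\<Sum>i. (1/2) ^ Suc i * \<bar>of_bool (seq x i) - of_bool (seq y i)\<bar>)"

lemma rho_summable:
  "summable (\<lambda>i. (1/2) ^ Suc i * \<bar>of_bool (seq x i) - of_bool (seq y i) :: real\<bar>)"
  by (rule summable_comparison_test'[of "\<lambda>i. (1/2::real) ^ Suc i" 0])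
     (auto simp: summable_Suc_iff of_bool_def)

lemma rho_ge_digit: "seq x i \<noteq> seq y i \<Longrightarrow> (1/2) ^ Suc i \<le> rho x y"
  using sum_le_suminf[OF rho_summable, of "{i}" x y] by (auto simp: rho_def of_bool_def split: if_splits)

lemma rho_le_agree:
  assumes "\<And>i. i < n \<Longrightarrow> seq x i = seq y i"
  shows "rho x y \<le> (1/2) ^ n"
proof -
  let ?f = "\<lambda>i. (1/2) ^ Suc i * \<bar>of_bool (seq x i) - of_bool (seq y i) :: real\<bar>"
  have "rho x y = (\<Sum>i. ?f (i + n)) + (\<Sum>i<n. ?f i)"
    unfolding rho_def by (rule suminf_split_initial_segment[OF rho_summable])
  also have "(\<Sum>i<n. ?f i) = 0"
    using assms by (intro sum.neutral) auto
  also have "(\<Sum>i. ?f (i + n)) \<le> (\<Sum>i. (1/2) ^ n * (1/2) ^ Suc i)"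
  proof (rule suminf_le)
    show "?f (i + n) \<le> (1/2) ^ n * (1/2) ^ Suc i" for i
      by (auto simp: of_bool_def power_add)
    show "summable (\<lambda>i. ?f (i + n))"
      by (rule summable_ignore_initial_segment[OF rho_summable])
    show "summable (\<lambda>i. (1/2::real) ^ n * (1/2) ^ Suc i)"
      by (intro summable_mult) (simp add: summable_Suc_iff)
  qed
  also have "\<dots> = (1/2) ^ n"
    using sums_mult[OF power_half_series, of "(1/2) ^ n"] by (simp add: sums_iff)
  finally show ?thesis by simp
qed

instantiation cantor :: metric_space
begin

definition dist_cantor :: "cantor \<Rightarrow> cantor \<Rightarrow> real" where
  "dist_cantor = rho"

definition uniformity_cantor :: "(cantor \<times> cantor) filter" where
  "uniformity_cantor = (INF e\<in>{0<..}. principal {(x, y). dist x y < e})"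

definition open_cantor :: "cantor set \<Rightarrow> bool" where
  "open_cantor U = (\<forall>x\<in>U. eventually (\<lambda>(x', y). x' = x \<longrightarrow> y \<in> U) uniformity)"

instance
proof
  fix x y z :: cantor
  show "dist x y = 0 \<longleftrightarrow> x = y"
  proof
    assume "dist x y = 0"
    have "seq x i = seq y i" for i
    proof (rule ccontr)
      assume "seq x i \<noteq> seq y i"
      then have "(1/2) ^ Suc i \<le> rho x y" by (rule rho_ge_digit)
      moreover have "(0::real) < (1/2) ^ Suc i" by simp
      ultimately show False using \<open>dist x y = 0\<close> unfolding dist_cantor_def by linarith
    qed
    then show "x = y" by (simp add: cantor_eq_iff)
  qed (simp add: dist_cantor_def rho_def)
  show "dist x y \<le> dist x z + dist y z"
    unfolding dist_cantor_def rho_def suminf_add[OF rho_summable rho_summable]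
    by (rule suminf_le[OF _ rho_summable summable_add[OF rho_summable rho_summable]])
       (auto simp: of_bool_def)
qed (fact uniformity_cantor_def open_cantor_def)+

end

definition G :: "nat \<Rightarrow> cantor set" where
  "G n = {x. \<forall>i<n. \<not> seq x i}"

text \<open>The metric topology is the one having the subgroups $G_n$ as a base at 0.\<close>

lemma dist_less_imp_agree: "dist x y < (1/2) ^ n \<Longrightarrow> i < n \<Longrightarrow> seq x i = seq y i"
proof (rule ccontr)
  assume *: "dist x y < (1/2) ^ n" "i < n" "seq x i \<noteq> seq y i"
  have "(1/2::real) ^ n \<le> (1/2) ^ Suc i"
    using \<open>i < n\<close> by (intro power_decreasing) auto
  with * rho_ge_digit[of x i y] show False by (simp add: dist_cantor_def)
qed

lemma open_cantor_iff: "open U \<longleftrightarrow> (\<forall>x\<in>U. \<exists>n. (+) x ` G n \<subseteq> U)"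
proof -
  have "(\<exists>e>0. \<forall>y. dist y x < e \<longrightarrow> y \<in> U) \<longleftrightarrow> (\<exists>n. (+) x ` G n \<subseteq> U)" for x
  proof
    assume "\<exists>e>0. \<forall>y. dist y x < e \<longrightarrow> y \<in> U"
    then obtain e where e: "e > 0" "\<And>y. dist y x < e \<Longrightarrow> y \<in> U" by blast
    obtain n where n: "(1/2::real) ^ n < e"
      using real_arch_pow_inv[of e "1/2"] e by auto
    have "x + g \<in> U" if "g \<in> G n" for g
    proof -
      have "dist (x + g) x \<le> (1/2) ^ n"
        unfolding dist_cantor_def using that by (intro rho_le_agree) (auto simp: G_def)
      with n e show ?thesis by auto
    qed
    then show "\<exists>n. (+) x ` G n \<subseteq> U" by blast
  next
    assume "\<exists>n. (+) x ` G n \<subseteq> U"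
    then obtain n where n: "(+) x ` G n \<subseteq> U" by blast
    have "y \<in> U" if "dist y x < (1/2) ^ n" for y
    proof -
      have "y - x \<in> G n" using dist_less_imp_agree[OF that] by (auto simp: G_def)
      then have "x + (y - x) \<in> U" using n by blast
      then show ?thesis by simp
    qed
    then show "\<exists>e>0. \<forall>y. dist y x < e \<longrightarrow> y \<in> U"
      by (intro exI[of _ "(1/2) ^ n"]) auto
  qed
  then show ?thesis by (simp add: open_dist)
qed

definition normalized_haar :: "cantor measure \<Rightarrow> bool" where
  "normalized_haar M \<longleftrightarrow>
     sets M = sets borel \<and> emeasure M UNIV = 1 \<and> (\<forall>a. distr M borel ((+) a) = M)"

text \<open>Such a measure exists: it is the law of a sequence of independent fair coin tosses.\<close>

definition coin :: "(nat \<Rightarrow> bool) measure" where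
  "coin = (\<Pi>\<^sub>M i\<in>UNIV. measure_pmf (bernoulli_pmf (1/2)))"

lemma space_coin [simp]: "space coin = UNIV"
  by (auto simp: coin_def space_PiM)

lemma prob_space_coin: "prob_space coin"
  unfolding coin_def by (intro prob_space_PiM prob_space_measure_pmf)

lemma digit_set_in_coin: "{f. \<forall>i<n. f i = g i} \<in> sets coin"
proof -
  have "{f \<in> space coin. \<forall>i\<in>{..<n}. f i = g i} \<in> sets coin"
  proof (rule sets.sets_Collect_finite_All)
    fix i
    have "(\<lambda>f. f i) -` {g i} \<inter> space coin \<in> sets coin"
      unfolding coin_def by (rule measurable_sets[OF measurable_component_singleton]) auto
    then show "{f \<in> space coin. f i = g i} \<in> sets coin"
      by (simp add: vimage_def)
  qed simp
  then show ?thesis by (simp add: Ball_def)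
qed

lemma Cantor_measurable: "Cantor \<in> measurable coin borel"
proof (rule borel_measurableI)
  fix U :: "cantor set"
  assume U: "open U"
  define C where "C n l = {f. \<forall>i<n. f i = l ! i}" for n and l :: "bool list"
  define A where "A = {B \<in> range (\<lambda>(n, l). C n l). B \<subseteq> Cantor -` U}"
  have "countable A"
    unfolding A_def by (rule countable_subset[OF _ countable_image[OF countableI_type]]) blast
  moreover have "A \<subseteq> sets coin"
    using digit_set_in_coin by (auto simp: A_def C_def)
  moreover have "\<Union> A = Cantor -` U"
  proof
    show "Cantor -` U \<subseteq> \<Union> A"
    proof
      fix f
      assume "f \<in> Cantor -` U"
      then obtain n where n: "(+) (Cantor f) ` G n \<subseteq> U"
        using U by (auto simp: open_cantor_iff)
      define l where "l = map f [0..<n]"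
      have "h \<in> Cantor -` U" if "h \<in> C n l" for h
      proof -
        have "Cantor h - Cantor f \<in> G n"
          using that by (auto simp: G_def C_def l_def)
        then have "Cantor f + (Cantor h - Cantor f) \<in> U" using n by blast
        then show ?thesis by simp
      qed
      moreover have "f \<in> C n l" by (auto simp: C_def l_def)
      moreover have "C n l \<in> range (\<lambda>(n, l). C n l)"
        by (rule image_eqI[of _ _ "(n, l)"]) simp_all
      ultimately have "f \<in> C n l" "C n l \<in> A" by (simp_all add: A_def subset_iff)
      then show "f \<in> \<Union> A" by (rule UnionI[rotated])
    qed
    show "\<Union> A \<subseteq> Cantor -` U" unfolding A_def by blast
  qed
  ultimately show "Cantor -` U \<inter> space coin \<in> sets coin"
    by (metis Int_UNIV_right space_coin sets.countable_Union)
qed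

lemma coin_flip_invariant: "distr coin coin (\<lambda>f i. a i \<noteq> f i) = coin"
proof -
  let ?B = "\<lambda>_::nat. measure_pmf (bernoulli_pmf (1/2))"
  interpret product_prob_space ?B UNIV
    by (simp add: product_prob_space_def product_sigma_finite_def product_prob_space_axioms_def
        prob_space_measure_pmf prob_space_imp_sigma_finite)
  have meas: "(\<lambda>f i. a i \<noteq> f i) \<in> measurable coin coin"
    unfolding coin_def
  proof (rule measurable_PiM_single')
    fix i :: nat
    show "(\<lambda>f. a i \<noteq> f i) \<in> measurable (Pi\<^sub>M UNIV ?B) (?B i)"
      by (rule measurable_compose[OF measurable_component_singleton]) auto
  qed (auto simp: space_PiM)
  have "distr coin coin (\<lambda>f i. a i \<noteq> f i) = PiM UNIV ?B"
  proof (rule PiM_eq)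
    fix J :: "nat set" and F :: "nat \<Rightarrow> bool set"
    assume J: "finite J" "J \<subseteq> UNIV" "\<And>i. i \<in> J \<Longrightarrow> F i \<in> sets (?B i)"
    have emb: "prod_emb UNIV ?B J (Pi\<^sub>E J H) = {f \<in> space (PiM UNIV ?B). \<forall>i\<in>J. f i \<in> H i}" for H
      by (auto simp: prod_emb_def space_PiM PiE_def Pi_def)
    have "emeasure (distr coin coin (\<lambda>f i. a i \<noteq> f i)) (prod_emb UNIV ?B J (Pi\<^sub>E J F)) =
        emeasure coin ((\<lambda>f i. a i \<noteq> f i) -` prod_emb UNIV ?B J (Pi\<^sub>E J F) \<inter> space coin)"
      using J by (intro emeasure_distr meas) (auto simp: coin_def intro!: sets_PiM_I)
    also have "(\<lambda>f i. a i \<noteq> f i) -` prod_emb UNIV ?B J (Pi\<^sub>E J F) \<inter> space coin =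
        prod_emb UNIV ?B J (Pi\<^sub>E J (\<lambda>i. {b. (a i \<noteq> b) \<in> F i}))"
      unfolding emb by (auto simp: space_PiM)
    also have "emeasure coin \<dots> = (\<Prod>i\<in>J. emeasure (?B i) {b. (a i \<noteq> b) \<in> F i})"
      unfolding coin_def using J by (intro emeasure_PiM_emb) auto
    also have "\<dots> = (\<Prod>i\<in>J. emeasure (?B i) (F i))"
    proof (rule prod.cong[OF refl])
      fix i
      have inv: "map_pmf (\<lambda>b. a i \<noteq> b) (bernoulli_pmf (1/2)) = bernoulli_pmf (1/2)"
      proof (cases "a i")
        case True
        have "pmf (map_pmf Not (bernoulli_pmf (1/2))) b = pmf (bernoulli_pmf (1/2)) b" for b
          using pmf_map_inj'[of Not "bernoulli_pmf (1/2)" "\<not> b"] by (cases b) (auto simp: inj_def)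
        then have "map_pmf Not (bernoulli_pmf (1/2)) = bernoulli_pmf (1/2)"
          by (rule pmf_eqI)
        moreover have "(\<lambda>b. a i \<noteq> b) = Not" using True by auto
        ultimately show ?thesis by simp
      next
        case False
        then have "(\<lambda>b. a i \<noteq> b) = (\<lambda>b. b)" by auto
        then show ?thesis by (simp add: map_pmf_ident)
      qed
      have "emeasure (?B i) {b. (a i \<noteq> b) \<in> F i} =
          emeasure (measure_pmf (map_pmf (\<lambda>b. a i \<noteq> b) (bernoulli_pmf (1/2)))) (F i)"
        by (simp add: vimage_def)
      then show "emeasure (?B i) {b. (a i \<noteq> b) \<in> F i} = emeasure (?B i) (F i)"
        by (simp only: inv)
    qed
    finally show "emeasure (distr coin coin (\<lambda>f i. a i \<noteq> f i)) (prod_emb UNIV ?B J (Pi\<^sub>E J F)) =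
      (\<Prod>i\<in>J. emeasure (?B i) (F i))" .
  qed (simp add: coin_def)
  then show ?thesis by (simp add: coin_def)
qed

lemma cantor_plus_continuous: "continuous_on UNIV ((+) (a :: cantor))"
proof -
  have "dist (a + x) (a + y) = dist x y" for x y
    unfolding dist_cantor_def rho_def
    by (intro arg_cong[where f = suminf] ext) (auto simp: of_bool_def)
  then show ?thesis by (auto simp: continuous_on_iff)
qed

lemma normalized_haar_exists: "normalized_haar (distr coin borel Cantor)"
  unfolding normalized_haar_def
proof (intro conjI allI)
  show "emeasure (distr coin borel Cantor) UNIV = 1"
    using prob_space.emeasure_space_1[OF prob_space_coin]
    by (simp add: emeasure_distr[OF Cantor_measurable])
  fix a :: cantor
  have plus: "(+) a \<in> measurable borel borel"
    by (rule borel_measurable_continuous_onI[OF cantor_plus_continuous])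
  have flip: "(\<lambda>f i. seq a i \<noteq> f i) \<in> measurable coin coin"
    unfolding coin_def
  proof (rule measurable_PiM_single')
    fix i :: nat
    show "(\<lambda>f. seq a i \<noteq> f i) \<in> measurable (\<Pi>\<^sub>M i\<in>UNIV. measure_pmf (bernoulli_pmf (1/2)))
        (measure_pmf (bernoulli_pmf (1/2)))"
      by (rule measurable_compose[OF measurable_component_singleton]) auto
  qed (auto simp: space_PiM)
  have "distr (distr coin borel Cantor) borel ((+) a) = distr coin borel ((+) a \<circ> Cantor)"
    by (rule distr_distr[OF plus Cantor_measurable])
  also have "(+) a \<circ> Cantor = Cantor \<circ> (\<lambda>f i. seq a i \<noteq> f i)"
    by (auto simp: cantor_eq_iff)
  also have "distr coin borel \<dots> = distr (distr coin coin (\<lambda>f i. seq a i \<noteq> f i)) borel Cantor"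
    by (rule distr_distr[OF Cantor_measurable flip, symmetric])
  finally show "distr (distr coin borel Cantor) borel ((+) a) = distr coin borel Cantor"
    unfolding coin_flip_invariant .
qed simp

definition K2 :: "nat \<Rightarrow> cantor set" where
  "K2 n = G (n - 1) - G n"

definition s_kernel :: "real \<Rightarrow> cantor \<Rightarrow> real" where
  "s_kernel s x = (if x = 0 then 0 else 2 powr (s * (real (THE n. 1 \<le> n \<and> x \<in> K2 n) - 1)))"

lemma K2_iff: "1 \<le> n \<Longrightarrow> x \<in> K2 n \<longleftrightarrow> (\<forall>i<n - 1. \<not> seq x i) \<and> seq x (n - 1)"
  by (cases n) (auto simp: K2_def G_def less_Suc_eq)

lemma K2_unique: "x \<noteq> 0 \<Longrightarrow> \<exists>!n. 1 \<le> n \<and> x \<in> K2 n"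
proof -
  assume "x \<noteq> 0"
  then obtain i where "seq x i" by (auto simp: cantor_eq_iff)
  define j where "j = (LEAST i. seq x i)"
  have j: "seq x j" "\<And>i. i < j \<Longrightarrow> \<not> seq x i"
    using \<open>seq x i\<close> by (auto simp: j_def intro: LeastI dest: not_less_Least)
  show ?thesis
  proof (rule ex1I[of _ "Suc j"])
    show "1 \<le> Suc j \<and> x \<in> K2 (Suc j)" using j by (simp add: K2_iff)
    fix n assume n: "1 \<le> n \<and> x \<in> K2 n"
    then have "\<not> n - 1 < j" "\<not> j < n - 1" using j by (auto simp: K2_iff)
    with n show "n = Suc j" by linarith
  qed
qed

lemma s_kernel_0: "s_kernel s 0 = 0"
  by (simp add: s_kernel_def)

lemma s_kernel_K2: "1 \<le> n \<Longrightarrow> x \<in> K2 n \<Longrightarrow> s_kernel s x = 2 powr (s * (real n - 1))"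
proof -
  assume n: "1 \<le> n" "x \<in> K2 n"
  then have "x \<noteq> 0" by (auto simp: K2_iff)
  with n K2_unique have "(THE n. 1 \<le> n \<and> x \<in> K2 n) = n" by (auto intro: the1_equality)
  with \<open>x \<noteq> 0\<close> show ?thesis by (simp add: s_kernel_def)
qed

definition walsh :: "nat \<Rightarrow> cantor \<Rightarrow> real" where
  "walsh k x = (-1) ^ (\<Sum>i | bit k i. of_bool (seq x i))"

lemma finite_bits: "finite {i. bit (k :: nat) i}"
proof (rule finite_subset)
  show "{i. bit k i} \<subseteq> {..<k}"
  proof
    fix i assume "i \<in> {i. bit k i}"
    then have "k div 2 ^ i \<noteq> 0" by (auto simp: bit_iff_odd intro: Nat.gr0I)
    then have "2 ^ i \<le> k" by (simp add: div_eq_0_iff not_less)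
    then show "i \<in> {..<k}" using less_le_trans[OF less_exp] by auto
  qed
qed simp

definition walsh_coeff :: "cantor measure \<Rightarrow> (cantor \<Rightarrow> real) \<Rightarrow> nat \<Rightarrow> real" where
  "walsh_coeff lam f k = (\<integral>x. f x * walsh k x \<partial>lam)"

definition walsh_coeff_measure :: "cantor measure \<Rightarrow> nat \<Rightarrow> real" where
  "walsh_coeff_measure mu k = (\<integral>x. walsh k x \<partial>mu)"

text \<open>
  The set \<open>E\<close> need not be Borel; \<open>AE\<close> says that its complement is contained in a Borel null set.
\<close>

definition mass_distribution :: "cantor measure \<Rightarrow> cantor set \<Rightarrow> bool" where
  "mass_distribution mu E \<longleftrightarrow>
     sets mu = sets borel \<and> finite_measure mu \<and> emeasure mu UNIV \<noteq> 0 \<and> (AE x in mu. x \<in> E)"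

definition non_atomic :: "cantor measure \<Rightarrow> bool" where
  "non_atomic mu \<longleftrightarrow> (\<forall>x. emeasure mu {x} = 0)"

definition hausdorff_pre :: "real \<Rightarrow> real \<Rightarrow> cantor set \<Rightarrow> ennreal" where
  "hausdorff_pre s \<delta> A =
     (INF I \<in> {I :: nat \<Rightarrow> cantor set. A \<subseteq> (\<Union>i. I i) \<and> (\<forall>i. diameter (I i) < \<delta>)}.
        \<Sum>i. ennreal (diameter (I i) powr s))"

definition hausdorff_measure :: "real \<Rightarrow> cantor set \<Rightarrow> ennreal" where
  "hausdorff_measure s A = Lim (at_right 0) (\<lambda>\<delta>. hausdorff_pre s \<delta> A)"

text \<open>
  The infimum is over positive exponents: the value at exponent 0 never affects it, and so no
  convention for $0^0$ is needed. For \<open>s > 0\<close> a set of diameter 0 contributes nothing to the sums.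
\<close>

definition hausdorff_dim :: "cantor set \<Rightarrow> ereal" where
  "hausdorff_dim A = (INF s \<in> {s. 0 < s \<and> hausdorff_measure s A = 0}. ereal s)"

lemma hausdorff_pre_antimono: "\<delta> \<le> \<delta>' \<Longrightarrow> hausdorff_pre s \<delta>' A \<le> hausdorff_pre s \<delta> A"
  unfolding hausdorff_pre_def by (rule INF_superset_mono) (auto intro: less_le_trans)

lemma hausdorff_pre_tendsto:
  "((\<lambda>\<delta>. hausdorff_pre s \<delta> A) \<longlongrightarrow> (SUP \<delta>\<in>{0<..}. hausdorff_pre s \<delta> A)) (at_right 0)"
proof (rule order_tendstoI)
  fix a assume "a < (SUP \<delta>\<in>{0<..}. hausdorff_pre s \<delta> A)"
  then obtain d where d: "d > 0" "a < hausdorff_pre s d A" by (auto simp: less_SUP_iff)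
  then show "\<forall>\<^sub>F \<delta> in at_right 0. a < hausdorff_pre s \<delta> A"
    unfolding eventually_at_right_field
    by (intro exI[of _ d]) (auto intro: less_le_trans hausdorff_pre_antimono less_imp_le)
next
  fix a assume a: "(SUP \<delta>\<in>{0<..}. hausdorff_pre s \<delta> A) < a"
  have "hausdorff_pre s \<delta> A < a" if "\<delta> > 0" for \<delta>
    by (rule le_less_trans[OF SUP_upper a]) (use that in auto)
  then show "\<forall>\<^sub>F \<delta> in at_right 0. hausdorff_pre s \<delta> A < a"
    unfolding eventually_at_right_field by (intro exI[of _ 1]) auto
qed

lemma hausdorff_measure_eq_SUP:
  "hausdorff_measure s A = (SUP \<delta>\<in>{0<..}. hausdorff_pre s \<delta> A)"
  unfolding hausdorff_measure_def by (rule tendsto_Lim[OF _ hausdorff_pre_tendsto]) simp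

end

theory Submission
  imports Defs
begin

text \<open>
  Only the partial sums over $k < 2^N$ are needed. Since $\sum_{k<2^N} w_k$ is $2^N$ times the
  indicator of $G_N$, the partial sum $P_N$ of the Walsh series of $\phi_s$ at $z$ is the mean of
  $\phi_s$ over $z + G_N$; hence $P_N \ge 0$, and $P_N \ge 2^{sn}$ on $G_n$ for $n \le N$.
  The function $V_N(x) = \int P_N(x+y)\,d\mu(y)$ satisfies $V_N(x) \ge 2^{sn}\mu(x+G_n)$ for
  $N \ge n$, and $\int V_N\,d\mu = \sum_{k<2^N} \widehat{\phi_s}(k)\,\widehat{\mu}(k)^2$ is bounded
  in $N$. By Fatou's lemma $\liminf_N V_N$ is finite almost everywhere, so it is bounded by a constant
  on a set of positive measure, where $\mu(x+G_n) \le M 2^{-sn}$ for all $n$; the mass distribution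
  principle concludes.
\<close>

section \<open>Cosets of the subgroups \<open>G n\<close> and Borel measurability\<close>

lemma mem_coset_iff: "y \<in> (+) x ` G n \<longleftrightarrow> (\<forall>i<n. seq y i = seq x i)"
proof
  assume "\<forall>i<n. seq y i = seq x i"
  then have "y - x \<in> G n" by (simp add: G_def)
  then have "x + (y - x) \<in> (+) x ` G n" by blast
  then show "y \<in> (+) x ` G n" by simp
qed (auto simp: G_def)

lemma open_coset: "open ((+) x ` G n)"
  unfolding open_cantor_iff
proof
  fix y assume "y \<in> (+) x ` G n"
  then have "(+) y ` G n \<subseteq> (+) x ` G n"
    by (auto simp: mem_coset_iff subset_iff simp del: image_iff)
  then show "\<exists>m. (+) y ` G m \<subseteq> (+) x ` G n" by blast
qed

lemma open_G: "open (G n)"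
  using open_coset[of 0 n] by simp

lemma coset_in_borel [measurable]: "(+) x ` G n \<in> sets borel"
  by (rule borel_open[OF open_coset])

lemma G_in_borel [measurable]: "G n \<in> sets borel"
  by (rule borel_open[OF open_G])

lemma K2_in_borel [measurable]: "K2 n \<in> sets borel"
  unfolding K2_def by measurable

lemma plus_measurable [measurable]: "(+) (a :: cantor) \<in> borel_measurable borel"
  by (rule borel_measurable_continuous_onI[OF cantor_plus_continuous])

lemma digit_measurable [measurable]: "(\<lambda>x. seq x i) \<in> measurable borel (count_space UNIV)"
proof -
  have "open {x. seq x i}"
    unfolding open_cantor_iff
  proof
    fix x assume "x \<in> {x. seq x i}"
    then have "(+) x ` G (Suc i) \<subseteq> {x. seq x i}"
      by (auto simp: G_def)
    then show "\<exists>n. (+) x ` G n \<subseteq> {x. seq x i}" by blast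
  qed
  then have "{x. seq x i} \<in> sets borel" by simp
  then show ?thesis
    by (simp add: pred_def)
qed

section \<open>Walsh functions and their Dirichlet kernel\<close>

lemma walsh_measurable [measurable]: "walsh k \<in> borel_measurable borel"
proof -
  have "walsh k = (\<lambda>x. \<Prod>i | bit k i. if seq x i then -1 else 1)"
    by (auto simp: walsh_def power_sum intro!: ext prod.cong)
  also have "\<dots> \<in> borel_measurable borel" by measurable
  finally show ?thesis .
qed

lemma abs_walsh [simp]: "\<bar>walsh k x\<bar> = 1"
  by (simp add: walsh_def power_abs)

text \<open>In the product over the set bits of \<open>k\<close>, each factor turns addition of
  digits modulo 2 into multiplication of signs: Walsh functions are characters of the group.\<close>

lemma walsh_plus: "walsh k (x + y) = walsh k x * walsh k y"
  unfolding walsh_def power_sum prod.distrib[symmetric]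
  by (rule prod.cong) auto

text \<open>Bit \<open>n\<close> of \<open>k\<close> is clear, so adding \<open>2 ^ n\<close> only
  sets it; the new factor is the sign given by digit \<open>n\<close> of \<open>x\<close>.\<close>

lemma walsh_add_power_of_two:
  assumes "k < 2 ^ n"
  shows "walsh (k + 2 ^ n) x = (if seq x n then - walsh k x else walsh k x)"
proof -
  have nb: "\<not> bit k i" if "n \<le> i" for i
    using assms that by (metis bit_take_bit_iff not_less take_bit_nat_eq_self)
  have "k + 2 ^ n = set_bit n k"
    using nb[of n] by (simp add: set_bit_eq)
  then have "{i. bit (k + 2 ^ n) i} = insert n {i. bit k i}"
    by (auto simp: bit_set_bit_iff)
  then show ?thesis
    using nb[of n] finite_bits[of k] by (simp add: walsh_def)
qed

text \<open>The upper half of the index block repeats the lower half times the sign of digit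
  \<open>n\<close>, so the sum doubles when that digit vanishes and cancels otherwise.\<close>

lemma walsh_dirichlet_kernel: "(\<Sum>k<2^n. walsh k x) = 2 ^ n * indicator (G n) x"
proof (induction n)
  case 0
  then show ?case by (simp add: walsh_def G_def)
next
  case (Suc n)
  have "(\<Sum>k<2^Suc n. walsh k x) = (\<Sum>k<2^n. walsh k x) + (\<Sum>k<2^n. walsh (k + 2^n) x)"
    using sum.atLeastLessThan_concat[of 0 "2^n" "2^Suc n" "\<lambda>k. walsh k x"]
      sum.shift_bounds_nat_ivl[of "\<lambda>k. walsh k x" 0 "2^n" "2^n"]
    by (simp add: lessThan_atLeast0 mult_2)
  also have "(\<Sum>k<2^n. walsh (k + 2^n) x) = (if seq x n then -1 else 1) * (\<Sum>k<2^n. walsh k x)"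
    by (auto simp: walsh_add_power_of_two sum_negf)
  finally show ?case
    using Suc by (auto simp: indicator_def G_def less_Suc_eq)
qed

section \<open>The \<open>s\<close>-kernel\<close>

lemma s_kernel_nonneg: "0 \<le> s_kernel s x"
  by (simp add: s_kernel_def)

text \<open>A nonzero point of \<open>G n\<close> has its first nonzero digit at index
  \<open>n\<close> or later, and the kernel does not decrease with that index. The origin is
  excluded because the kernel is set to 0 there.\<close>

lemma s_kernel_ge:
  assumes "0 \<le> s" "x \<in> G n" "x \<noteq> 0"
  shows "2 powr (s * real n) \<le> s_kernel s x"
proof -
  obtain m where m: "1 \<le> m" "x \<in> K2 m"
    using K2_unique[OF \<open>x \<noteq> 0\<close>] by blast
  then have "n \<le> m - 1"
    using assms(2) by (auto simp: K2_iff G_def intro: leI)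
  then have "real n \<le> real m - 1" using m by linarith
  then show ?thesis
    using assms(1) by (simp add: s_kernel_K2[OF m] mult_left_mono)
qed

text \<open>The sets \<open>K2\<close> are disjoint, so at most one term is nonzero. This form gives
  both measurability and termwise integration.\<close>

lemma s_kernel_sums: "(\<lambda>n. 2 powr (s * real n) * indicator (K2 (Suc n)) x) sums s_kernel s x"
proof (cases "x = 0")
  case True
  then show ?thesis by (simp add: s_kernel_0 K2_iff indicator_def)
next
  case False
  then obtain m where m: "1 \<le> m" "x \<in> K2 m" and unique: "\<And>n. 1 \<le> n \<and> x \<in> K2 n \<Longrightarrow> n = m"
    using K2_unique by (blast elim: ex1E)
  have "(\<lambda>n. 2 powr (s * real n) * indicator (K2 (Suc n)) x) =
      (\<lambda>n. if n = m - 1 then s_kernel s x else 0)"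
  proof
    fix n
    show "2 powr (s * real n) * indicator (K2 (Suc n)) x = (if n = m - 1 then s_kernel s x else 0)"
    proof (cases "n = m - 1")
      case True
      then have "m = Suc n" using m(1) by simp
      then show ?thesis using m s_kernel_K2[OF m, of s] by simp
    next
      case False
      then have "x \<notin> K2 (Suc n)" using unique[of "Suc n"] by auto
      then show ?thesis using False by simp
    qed
  qed
  then show ?thesis
    using sums_single[of "m - 1" "\<lambda>_. s_kernel s x"] by simp
qed

lemma s_kernel_measurable [measurable]: "s_kernel s \<in> borel_measurable borel"
proof -
  have "s_kernel s = (\<lambda>x. \<Sum>n. 2 powr (s * real n) * indicator (K2 (Suc n)) x)"
    using s_kernel_sums by (auto simp: sums_iff)
  also have "\<dots> \<in> borel_measurable borel" by measurable
  finally show ?thesis .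
qed

section \<open>Haar measure and integrability of the kernel\<close>

locale haar =
  fixes lam :: "cantor measure"
  assumes normalized_haar: "normalized_haar lam"
begin

lemma sets_lam [simp, measurable_cong]: "sets lam = sets borel"
  using normalized_haar by (simp add: normalized_haar_def)

lemma space_lam [simp]: "space lam = UNIV"
  using sets_eq_imp_space_eq[OF sets_lam] by simp

sublocale prob_space lam
  using normalized_haar by (intro prob_spaceI) (simp add: normalized_haar_def)

lemma distr_plus: "distr lam borel ((+) a) = lam"
  using normalized_haar by (simp add: normalized_haar_def)

lemma measure_coset: "measure lam ((+) a ` G n) = measure lam (G n)"
proof -
  have "measure lam ((+) a ` G n) = measure (distr lam borel ((+) a)) ((+) a ` G n)"
    by (simp add: distr_plus)
  also have "\<dots> = measure lam ((+) a -` ((+) a ` G n))"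
    by (subst measure_distr) simp_all
  also have "(+) a -` ((+) a ` G n) = G n"
    by (auto simp: inj_vimage_image_eq)
  finally show ?thesis .
qed

text \<open>\<open>G n\<close> is the disjoint union of \<open>G (Suc n)\<close> and its translate
  by \<open>?e\<close>, the point whose only nonzero digit is digit \<open>n\<close>; invariance
  makes the two halves equal.\<close>

lemma measure_G: "measure lam (G n) = (1/2) ^ n"
proof (induction n)
  case 0
  have "G 0 = space lam" by (simp add: G_def)
  then show ?case by (simp add: prob_space del: space_lam)
next
  case (Suc n)
  let ?e = "Cantor (\<lambda>i. i = n)"
  have "G n = G (Suc n) \<union> (+) ?e ` G (Suc n)"
    unfolding set_eq_iff Un_iff mem_coset_iff by (auto simp: G_def less_Suc_eq)
  moreover have "G (Suc n) \<inter> (+) ?e ` G (Suc n) = {}"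
    unfolding set_eq_iff Int_iff mem_coset_iff by (auto simp: G_def less_Suc_eq)
  ultimately have "measure lam (G n) = measure lam (G (Suc n)) + measure lam ((+) ?e ` G (Suc n))"
    by (metis finite_measure_Union sets_lam coset_in_borel G_in_borel)
  then show ?case
    using Suc by (simp add: measure_coset)
qed

text \<open>The origin lies in every \<open>G n\<close>. It has to be discarded when the kernel is
  bounded from below.\<close>

lemma AE_nonzero: "AE x in lam. x \<noteq> 0"
proof -
  have "measure lam {0} \<le> (1/2) ^ n" for n
    using finite_measure_mono[of "{0}" "G n"] by (simp add: measure_G) (simp add: G_def)
  then have "measure lam {0} \<le> 0"
    by (intro LIMSEQ_le_const[OF LIMSEQ_power_zero[of "1/2"]]) auto
  then have "emeasure lam {0} = 0"
    using measure_nonneg[of lam "{0}"] by (simp add: emeasure_eq_measure del: measure_nonneg)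
  then show ?thesis
    by (intro AE_I[of _ _ "{0}"]) auto
qed

text \<open>Termwise integration leads to a geometric series of ratio \<open>2 powr (s - 1)\<close>,
  which is below 1 because \<open>s < 1\<close>.\<close>

lemma integrable_s_kernel:
  assumes "s < 1"
  shows "integrable lam (s_kernel s)"
proof (rule integrableI_nonneg)
  have "(\<integral>\<^sup>+x. ennreal (s_kernel s x) \<partial>lam) =
      (\<integral>\<^sup>+x. (\<Sum>n. ennreal (2 powr (s * real n) * indicator (K2 (Suc n)) x)) \<partial>lam)"
    using s_kernel_sums by (intro nn_integral_cong) (simp add: suminf_ennreal2 sums_iff)
  also have "\<dots> = (\<Sum>n. \<integral>\<^sup>+x. ennreal (2 powr (s * real n) * indicator (K2 (Suc n)) x) \<partial>lam)"
    by (rule nn_integral_suminf) measurable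
  also have "\<dots> \<le> (\<Sum>n. ennreal ((2 powr (s - 1)) ^ n))"
  proof (intro suminf_le)
    fix n
    have "(\<integral>\<^sup>+x. ennreal (2 powr (s * real n) * indicator (K2 (Suc n)) x) \<partial>lam) =
        ennreal (2 powr (s * real n)) * emeasure lam (K2 (Suc n))"
      by (subst nn_integral_cmult_indicator[symmetric])
         (auto simp: indicator_def intro!: nn_integral_cong)
    \<comment> \<open>Enlarging to \<open>G n\<close> costs only a factor 2, which does not affect
      convergence.\<close>
    also have "emeasure lam (K2 (Suc n)) \<le> emeasure lam (G n)"
      by (intro emeasure_mono) (auto simp: K2_def)
    also have "ennreal (2 powr (s * real n)) * emeasure lam (G n) =
        ennreal (2 powr (s * real n) * (1/2) ^ n)"
      by (simp add: emeasure_eq_measure measure_G ennreal_mult)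
    also have "2 powr (s * real n) * (1/2) ^ n = (2 powr (s - 1)) ^ n"
      by (simp add: powr_diff power_divide powr_powr[symmetric] powr_realpow)
    finally show "(\<integral>\<^sup>+x. ennreal (2 powr (s * real n) * indicator (K2 (Suc n)) x) \<partial>lam)
        \<le> ennreal ((2 powr (s - 1)) ^ n)"
      by (simp add: mult_left_mono)
  qed auto
  also have "2 powr (s - 1) < (1 :: real)"
    using powr_less_mono[of "s - 1" 0 2] assms by simp
  then have "(\<Sum>n. ennreal ((2 powr (s - 1)) ^ n)) < \<infinity>"
    by (subst suminf_ennreal2) (auto intro: summable_geometric)
  finally show "(\<integral>\<^sup>+x. ennreal (s_kernel s x) \<partial>lam) < \<infinity>" .
qed (auto simp: s_kernel_nonneg)

section \<open>Partial sums of the Walsh series of the kernel\<close>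

lemma integral_dirichlet_translate: "(\<integral>u. 2 ^ n * indicator (G n) (z + u) \<partial>lam) = (1 :: real)"
proof -
  have "(\<integral>u. 2 ^ n * indicator (G n) (z + u) \<partial>lam) =
      (\<integral>u. 2 ^ n * indicator (G n) u \<partial>distr lam borel ((+) z) :: real)"
    by (subst integral_distr) simp_all
  also have "\<dots> = 1"
    by (simp add: distr_plus measure_G power_one_over)
  finally show ?thesis .
qed

text \<open>The characters at \<open>u\<close> and \<open>z\<close> multiply to the character at
  \<open>z + u\<close>, so summing under the integral produces the Dirichlet kernel. Integrability
  is recorded for the later comparison of integrals.\<close>

lemma s_kernel_partial_sum:
  assumes "s < 1"
  shows "(\<Sum>k<2^n. walsh_coeff lam (s_kernel s) k * walsh k z) =
    (\<integral>u. s_kernel s u * (2 ^ n * indicator (G n) (z + u)) \<partial>lam)"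
    and "integrable lam (\<lambda>u. s_kernel s u * (2 ^ n * indicator (G n) (z + u)))"
proof -
  have int: "integrable lam (\<lambda>u. s_kernel s u * walsh k u * walsh k z)" for k
    by (intro integrable_mult_left Bochner_Integration.integrable_bound[OF integrable_s_kernel[OF assms]])
       (auto simp: abs_mult)
  have eq: "(\<Sum>k<2^n. s_kernel s u * walsh k u * walsh k z) =
      s_kernel s u * (2 ^ n * indicator (G n) (z + u))" for u
    unfolding walsh_dirichlet_kernel[symmetric] walsh_plus sum_distrib_left
    by (simp add: mult_ac)
  have "(\<Sum>k<2^n. walsh_coeff lam (s_kernel s) k * walsh k z) =
      (\<integral>u. (\<Sum>k<2^n. s_kernel s u * walsh k u * walsh k z) \<partial>lam)"
    unfolding walsh_coeff_def using int
    by (subst Bochner_Integration.integral_sum) auto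
  then show "(\<Sum>k<2^n. walsh_coeff lam (s_kernel s) k * walsh k z) =
      (\<integral>u. s_kernel s u * (2 ^ n * indicator (G n) (z + u)) \<partial>lam)"
    by (simp only: eq)
  have "integrable lam (\<lambda>u. \<Sum>k<2^n. s_kernel s u * walsh k u * walsh k z)"
    by (rule Bochner_Integration.integrable_sum[OF int])
  then show "integrable lam (\<lambda>u. s_kernel s u * (2 ^ n * indicator (G n) (z + u)))"
    by (simp only: eq)
qed

lemma s_kernel_partial_sum_nonneg:
  assumes "s < 1"
  shows "0 \<le> (\<Sum>k<2^n. walsh_coeff lam (s_kernel s) k * walsh k z)"
  unfolding s_kernel_partial_sum(1)[OF assms]
  by (intro Bochner_Integration.integral_nonneg) (simp add: s_kernel_nonneg)

lemma s_kernel_partial_sum_ge: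
  assumes "0 \<le> s" "s < 1" "m \<le> n" "z \<in> G m"
  shows "2 powr (s * real m) \<le> (\<Sum>k<2^n. walsh_coeff lam (s_kernel s) k * walsh k z)"
proof -
  have [measurable]: "(\<lambda>u. indicator (G n) (z + u) :: real) \<in> borel_measurable lam"
    by measurable
  \<comment> \<open>The constant is averaged against a kernel of total mass 1, so that both sides
    are integrals over the same set.\<close>
  have "2 powr (s * real m) = (\<integral>u. 2 powr (s * real m) * (2 ^ n * indicator (G n) (z + u)) \<partial>lam)"
    by (subst integral_mult_right_zero) (simp only: integral_dirichlet_translate mult_1_right)
  also have "\<dots> \<le> (\<integral>u. s_kernel s u * (2 ^ n * indicator (G n) (z + u)) \<partial>lam)"
  proof (rule integral_mono_AE)
    show "integrable lam (\<lambda>u. 2 powr (s * real m) * (2 ^ n * indicator (G n) (z + u)))"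
      by (rule integrable_const_bound[of _ "2 powr (s * real m) * 2 ^ n"])
         (auto simp: indicator_def)
    show "AE u in lam. 2 powr (s * real m) * (2 ^ n * indicator (G n) (z + u))
        \<le> s_kernel s u * (2 ^ n * indicator (G n) (z + u))"
      using AE_nonzero
    proof eventually_elim
      case (elim u)
      \<comment> \<open>Every element is its own inverse, so \<open>u\<close> is the sum of
        \<open>z\<close> and \<open>z + u\<close>, both in \<open>G m\<close>: the whole averaging
        set lies where the kernel is large.\<close>
      have "u \<in> G m" if "z + u \<in> G n"
        using that assms(3,4) by (auto simp: G_def)
      then show ?case
        using s_kernel_ge[OF assms(1) _ elim] by (auto simp: indicator_def)
    qed
  qed (rule s_kernel_partial_sum(2)[OF assms(2)])
  finally show ?thesis
    unfolding s_kernel_partial_sum(1)[OF assms(2)] .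
qed

end

section \<open>The mass distribution principle\<close>

lemma dist_cantor_le_1: "dist x y \<le> (1 :: real)" for x y :: cantor
  using rho_le_agree[of 0 x y] by (simp add: dist_cantor_def)

text \<open>\<open>diameter\<close> is a real supremum, which dominates distances for bounded sets;
  here every set is bounded.\<close>

lemma dist_le_diameter_cantor: "x \<in> S \<Longrightarrow> y \<in> S \<Longrightarrow> dist x y \<le> diameter S" for S :: "cantor set"
  by (rule diameter_bounded_bound) (auto simp: bounded_def intro: dist_cantor_le_1)

text \<open>A covering set of diameter d with 0 < d < 1 that meets \<open>A\<close> at
  \<open>x\<close> has its points in a coset \<open>(+) x\<close> + "\<open>G n\<close>" with 2^-n
  at most 2d, whose mass is at most M 2^s d^t. Summation bounds the cost of every cover from
  below.\<close>

lemma mass_distribution_principle: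
  fixes mu :: "cantor measure"
  assumes sets: "sets mu = sets borel" and E: "AE x in mu. x \<in> E"
    and "non_atomic mu" and A: "A \<in> sets borel" "emeasure mu A \<noteq> 0"
    and coset: "\<And>x n. x \<in> A \<Longrightarrow> emeasure mu ((+) x ` G n) \<le> ennreal (M * 2 powr (- s * real n))"
    and "0 < M" "0 \<le> t" "t \<le> s"
  shows "hausdorff_measure t E \<noteq> 0"
proof
  assume "hausdorff_measure t E = 0"
  \<comment> \<open>The Hausdorff measure is a supremum over \<open>\<delta>\<close>, so the value
    at scale 1 vanishes too.\<close>
  then have pre: "hausdorff_pre t 1 E = 0"
    using SUP_upper[of "1::real" "{0<..}" "\<lambda>\<delta>. hausdorff_pre t \<delta> E"]
    by (simp add: hausdorff_measure_eq_SUP)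
  have cover: "emeasure mu A \<le> ennreal (M * 2 powr s) * (\<Sum>i. ennreal (diameter (I i) powr t))"
    if I: "E \<subseteq> (\<Union>i. I i)" "\<And>i. diameter (I i) < 1" for I :: "nat \<Rightarrow> cantor set"
  proof -
    \<comment> \<open>Covering sets are arbitrary, so each trace on \<open>A\<close> is first
      enclosed in a Borel set.\<close>
    have "\<exists>B\<in>sets borel. A \<inter> I i \<subseteq> B \<and>
        emeasure mu B \<le> ennreal (M * 2 powr s) * ennreal (diameter (I i) powr t)" for i
    proof (cases "A \<inter> I i = {}")
      case True
      then show ?thesis by (intro bexI[of _ "{}"]) auto
    next
      case False
      then obtain x where x: "x \<in> A" "x \<in> I i" by blast
      define d where "d = diameter (I i)"
      have d: "dist y x \<le> d" if "y \<in> I i" for y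
        using dist_le_diameter_cantor that x by (simp add: d_def)
      show ?thesis
      proof (cases "d = 0")
        case True
        \<comment> \<open>Such a set contributes 0 to the sum, so its trace must be null; being a
          single point, it is null because \<open>mu\<close> is non-atomic.\<close>
        then have "A \<inter> I i \<subseteq> {x}" using d by auto
        then show ?thesis
          using \<open>non_atomic mu\<close> by (intro bexI[of _ "{x}"]) (auto simp: non_atomic_def)
      next
        case False
        then have "0 < d" using d[OF x(2)] by simp
        have "d < 1" using I(2) by (simp add: d_def)
        \<comment> \<open>The first dyadic scale not exceeding \<open>d\<close>: 2^-m <= d <
          2^-(m-1), with m positive since d < 1. The upper bound selects the coset at level
          \<open>n = m - 1\<close>, the lower one turns its mass bound into a power of
          \<open>d\<close>.\<close>
        define m where "m = (LEAST m. (1/2) ^ m \<le> d)"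
        have "\<exists>m. (1/2) ^ m \<le> d"
          using real_arch_pow_inv[OF \<open>0 < d\<close>, of "1/2"] by (auto intro: less_imp_le)
        then have m: "(1/2) ^ m \<le> d"
          unfolding m_def by (rule LeastI_ex)
        then obtain n where n: "m = Suc n"
          using \<open>d < 1\<close> by (cases m) auto
        have n': "d < (1/2) ^ n"
          using not_less_Least[of n "\<lambda>m. (1/2) ^ m \<le> d"] n by (simp add: m_def)
        have "A \<inter> I i \<subseteq> (+) x ` G n"
          unfolding subset_iff mem_coset_iff
          using dist_less_imp_agree[OF le_less_trans[OF d n']] by blast
        moreover have "emeasure mu ((+) x ` G n) \<le> ennreal (M * 2 powr s * d powr t)"
        proof -
          have "((1/2) ^ m) powr s = (2 powr (- real m)) powr s"
            by (simp add: powr_minus powr_realpow power_one_over inverse_eq_divide del: powr_powr)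
          then have "2 powr (- s * real n) = 2 powr s * ((1/2) ^ m) powr s"
            by (simp add: n powr_powr algebra_simps flip: powr_add)
          also have "\<dots> \<le> 2 powr s * d powr s"
            using m assms by (intro mult_left_mono powr_mono2) auto
          also have "d powr s \<le> d powr t"
            using \<open>0 < d\<close> \<open>d < 1\<close> assms by (intro powr_mono') auto
          finally have "M * 2 powr (- s * real n) \<le> M * (2 powr s * d powr t)"
            using assms by (intro mult_left_mono) auto
          then show ?thesis
            using coset[OF x(1), of n] by (auto simp: mult.assoc intro: order_trans ennreal_leI)
        qed
        ultimately show ?thesis
          using assms by (intro bexI[of _ "(+) x ` G n"]) (auto simp: d_def ennreal_mult)
      qed
    qed
    then obtain B where B: "\<And>i. B i \<in> sets borel" "\<And>i. A \<inter> I i \<subseteq> B i"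
      "\<And>i. emeasure mu (B i) \<le> ennreal (M * 2 powr s) * ennreal (diameter (I i) powr t)"
      by metis
    have "emeasure mu A \<le> emeasure mu (\<Union>i. B i)"
    proof (rule emeasure_mono_AE)
      \<comment> \<open>\<open>A\<close> need not be a subset of \<open>E\<close>; the cover catches
        almost all of it.\<close>
      show "AE x in mu. x \<in> A \<longrightarrow> x \<in> (\<Union>i. B i)"
        using E by eventually_elim (use I(1) B(2) in blast)
    qed (use B sets in auto)
    also have "\<dots> \<le> (\<Sum>i. emeasure mu (B i))"
      using B sets by (intro emeasure_subadditive_countably) auto
    also have "\<dots> \<le> (\<Sum>i. ennreal (M * 2 powr s) * ennreal (diameter (I i) powr t))"
      by (intro suminf_le B) auto
    finally show ?thesis by simp
  qed
  \<comment> \<open>The bound is uniform over covers, so the infimum is at least a positive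
    number.\<close>
  have "emeasure mu A / ennreal (M * 2 powr s) \<le> hausdorff_pre t 1 E"
    unfolding hausdorff_pre_def
    by (intro INF_greatest divide_le_posI_ennreal cover) (use \<open>0 < M\<close> in auto)
  then show False using pre A by (simp add: ennreal_divide_eq_0_iff)
qed

section \<open>From bounded energy to a growth condition\<close>

text \<open>Supplies the Frostman-type condition for the mass distribution principle, with one
  constant for all levels \<open>n\<close> and all points of \<open>A\<close>.\<close>

lemma finite_energy_imp_density_bound:
  fixes mu lam :: "cantor measure"
  assumes haar: "normalized_haar lam" and s: "0 \<le> s" "s < 1"
    and sets: "sets mu = sets borel" and "finite_measure mu" and nz: "emeasure mu UNIV \<noteq> 0"
    and summable: "summable (\<lambda>k. walsh_coeff lam (s_kernel s) k * (walsh_coeff_measure mu k)\<^sup>2)"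
  obtains A M where "A \<in> sets borel" "emeasure mu A \<noteq> 0" "0 < M"
    "\<And>x n. x \<in> A \<Longrightarrow> emeasure mu ((+) x ` G n) \<le> ennreal (M * 2 powr (- s * real n))"
proof -
  interpret haar lam using haar by unfold_locales
  interpret mu: finite_measure mu by fact
  note [measurable_cong] = sets
  have space_mu [simp]: "space mu = UNIV"
    using sets_eq_imp_space_eq[OF sets] by simp
  define P where "P N z = (\<Sum>k<2^N. walsh_coeff lam (s_kernel s) k * walsh k z)" for N z
  \<comment> \<open>A truncated potential of \<open>mu\<close>: the convolution with
    \<open>P N\<close>, since addition and subtraction coincide in this group.\<close>
  define V where "V N x = (\<integral>y. P N (x + y) \<partial>mu)" for N x
  have int_walsh [simp]: "integrable mu (walsh k)" for k
    by (rule mu.integrable_const_bound[of _ 1]) auto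
  have P_plus: "P N (x + y) =
      (\<Sum>k<2^N. walsh_coeff lam (s_kernel s) k * walsh k x * walsh k y)" for N x y
    by (simp add: P_def walsh_plus mult.assoc)
  have int_P: "integrable mu (\<lambda>y. P N (x + y))" for N x
    unfolding P_plus by simp
  \<comment> \<open>\<open>V N\<close> is a finite Walsh sum, so it is measurable and integrable,
    and a further integration gives the square of each coefficient of \<open>mu\<close>.\<close>
  have V_eq: "V N x =
      (\<Sum>k<2^N. walsh_coeff lam (s_kernel s) k * walsh_coeff_measure mu k * walsh k x)" for N x
    unfolding V_def P_plus walsh_coeff_measure_def
    by (subst Bochner_Integration.integral_sum) (auto intro!: sum.cong)
  have V_meas [measurable]: "V N \<in> borel_measurable mu" for N
    unfolding V_eq[abs_def] by measurable
  have int_V: "integrable mu (V N)" for N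
    unfolding V_eq[abs_def] by simp
  have V_nonneg: "0 \<le> V N x" for N x
    unfolding V_def P_def
    by (intro Bochner_Integration.integral_nonneg s_kernel_partial_sum_nonneg s)
  have V_ge: "2 powr (s * real n) * measure mu ((+) x ` G n) \<le> V N x" if "n \<le> N" for n N x
  proof -
    have "2 powr (s * real n) * measure mu ((+) x ` G n) =
        (\<integral>y. 2 powr (s * real n) * indicator ((+) x ` G n) y \<partial>mu)"
      by simp
    also have "\<dots> \<le> V N x"
      unfolding V_def
    proof (intro integral_mono int_P)
      fix y
      show "2 powr (s * real n) * indicator ((+) x ` G n) y \<le> P N (x + y)"
      proof (cases "y \<in> (+) x ` G n")
        case True
        then have "x + y \<in> G n" unfolding mem_coset_iff by (simp add: G_def)
        then show ?thesis
          using s_kernel_partial_sum_ge[OF s that] True by (simp add: P_def)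
      next
        case False
        then show ?thesis
          using s_kernel_partial_sum_nonneg[OF s(2)] by (simp add: P_def)
      qed
    qed (simp add: sets mu.emeasure_finite less_top[symmetric])
    finally show ?thesis .
  qed
  obtain C where C: "\<And>N. (\<Sum>k<N. walsh_coeff lam (s_kernel s) k * (walsh_coeff_measure mu k)\<^sup>2) \<le> C"
    using convergent_imp_Bseq[OF summable[unfolded summable_iff_convergent]]
    by (auto simp: Bseq_def) (metis abs_le_D1)
  have int_V_le: "(\<integral>\<^sup>+x. ennreal (V N x) \<partial>mu) \<le> ennreal C" for N
  proof -
    have "(\<integral>\<^sup>+x. ennreal (V N x) \<partial>mu) = ennreal (\<integral>x. V N x \<partial>mu)"
      by (rule nn_integral_eq_integral[OF int_V]) (simp add: V_nonneg)
    also have "(\<integral>x. V N x \<partial>mu) =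
        (\<Sum>k<2^N. walsh_coeff lam (s_kernel s) k * (walsh_coeff_measure mu k)\<^sup>2)"
      unfolding V_eq
      by (subst Bochner_Integration.integral_sum)
         (auto simp: walsh_coeff_measure_def power2_eq_square mult.assoc)
    finally show ?thesis
      using C by (simp add: ennreal_leI)
  qed
  \<comment> \<open>The lower limit allows Fatou's lemma without convergence of
    \<open>V N x\<close>, and it keeps every lower bound valid for all \<open>N \<ge> n\<close>,
    hence the bounds for all \<open>n\<close> at once.\<close>
  define W where "W x = liminf (\<lambda>N. ennreal (V N x))" for x
  have [measurable]: "W \<in> borel_measurable mu"
    unfolding W_def by measurable
  have "(\<integral>\<^sup>+x. W x \<partial>mu) \<le> liminf (\<lambda>N. \<integral>\<^sup>+x. ennreal (V N x) \<partial>mu)"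
    unfolding W_def by (rule nn_integral_liminf) measurable
  also have "\<dots> \<le> ennreal C"
    by (intro Liminf_le always_eventually allI int_V_le) simp_all
  finally have "(\<integral>\<^sup>+x. W x \<partial>mu) \<noteq> \<infinity>"
    by (auto simp: top_unique)
  then have fin: "AE x in mu. W x \<noteq> \<infinity>"
    by (intro nn_integral_PInf_AE) auto
  \<comment> \<open>These sublevel sets exhaust the set where \<open>W\<close> is finite, which has
    full measure; if all were null, \<open>mu\<close> would vanish.\<close>
  have "\<exists>M::nat. emeasure mu {x. W x \<le> of_nat M} \<noteq> 0"
  proof (rule ccontr)
    assume "\<not> ?thesis"
    then have "AE x in mu. \<not> W x \<le> of_nat M" for M :: nat
      by (intro AE_I[of _ _ "{x. W x \<le> of_nat M}"]) auto
    then have "AE x in mu. \<forall>M::nat. \<not> W x \<le> of_nat M"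
      by (simp add: AE_all_countable)
    with fin have "AE x in mu. False"
    proof eventually_elim
      case (elim x)
      then show ?case
        using ennreal_Ex_less_of_nat[of "W x"] by (auto simp: less_top intro: less_imp_le)
    qed
    then show False
      using nz by (simp add: AE_iff_null null_sets_def)
  qed
  then obtain M :: nat where M: "emeasure mu {x. W x \<le> of_nat M} \<noteq> 0" ..
  show ?thesis
  \<comment> \<open>Adding 1 makes the constant strictly positive even when \<open>M\<close> is
    0.\<close>
  proof (rule that[of "{x. W x \<le> of_nat M}" "real M + 1"])
    have "{x \<in> space mu. W x \<le> of_nat M} \<in> sets mu" by measurable
    then show "{x. W x \<le> of_nat M} \<in> sets borel" by (simp add: sets)
    fix x n
    assume x: "x \<in> {x. W x \<le> of_nat M}"
    have "ennreal (2 powr (s * real n) * measure mu ((+) x ` G n)) \<le> W x"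
      unfolding W_def
      by (intro Liminf_bounded eventually_sequentiallyI[of n] ennreal_leI V_ge)
    also have "\<dots> \<le> ennreal (real M)" using x by (simp add: ennreal_of_nat_eq_real_of_nat)
    also have "\<dots> \<le> ennreal (real M + 1)" by (rule ennreal_leI) simp
    finally have "2 powr (s * real n) * measure mu ((+) x ` G n) \<le> real M + 1"
      by (subst (asm) ennreal_le_iff) simp_all
    then have "measure mu ((+) x ` G n) \<le> (real M + 1) * 2 powr (- s * real n)"
      by (simp add: powr_minus field_simps)
    then show "emeasure mu ((+) x ` G n) \<le> ennreal ((real M + 1) * 2 powr (- s * real n))"
      by (simp add: mu.emeasure_eq_measure ennreal_leI)
  qed (use M in simp_all)
qed

theorem theorem3:
  fixes s :: real and E :: "cantor set" and lam :: "cantor measure"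
  assumes "0 < s" "s < 1"
    and "normalized_haar lam"
    and "\<exists>mu. mass_distribution mu E \<and> non_atomic mu \<and>
           summable (\<lambda>k. walsh_coeff lam (s_kernel s) k * (walsh_coeff_measure mu k)\<^sup>2)"
  shows "ereal s \<le> hausdorff_dim E"
proof -
  obtain mu where mu: "sets mu = sets borel" "finite_measure mu" "emeasure mu UNIV \<noteq> 0"
      "AE x in mu. x \<in> E" "non_atomic mu"
      "summable (\<lambda>k. walsh_coeff lam (s_kernel s) k * (walsh_coeff_measure mu k)\<^sup>2)"
    using assms(4) by (auto simp: mass_distribution_def)
  obtain A M where A: "A \<in> sets borel" "emeasure mu A \<noteq> 0" "0 < M"
    "\<And>x n. x \<in> A \<Longrightarrow> emeasure mu ((+) x ` G n) \<le> ennreal (M * 2 powr (- s * real n))"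
    using finite_energy_imp_density_bound[OF assms(3) _ assms(2) mu(1-3,6)] assms(1)
    by (metis less_imp_le)
  show ?thesis
    unfolding hausdorff_dim_def
  proof (rule INF_greatest)
    fix t assume "t \<in> {t. 0 < t \<and> hausdorff_measure t E = 0}"
    then have t: "0 < t" "hausdorff_measure t E = 0" by auto
    \<comment> \<open>For exponents up to \<open>s\<close> the Hausdorff measure of \<open>E\<close>
      is nonzero, so every exponent in the infimum exceeds \<open>s\<close>.\<close>
    have "\<not> t \<le> s"
      using mass_distribution_principle[OF mu(1,4,5) A(1,2,4,3)] t by force
    then show "ereal s \<le> ereal t" by simp
  qed
qed

end
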